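(* For any kernel $K$ (a monotone decreasing function of $\|\mathbf{p}-\mathbf{q}\|$), the expected query time of the importance-sampling query procedure described in the context is $\widetilde{O}\left(\epsilon^{-2}\, n^{o(1)}\cdot \mathrm{cost}(K)\right)$.
   Context: Let $P=\{\mathbf{p}_1,\dots,\mathbf{p}_n\}\subset\mathbb{R}^d$, let $\mathbf{q}\in\mathbb{R}^d$ be a query, and let $K(\mathbf{p},\mathbf{q})=f(\|\mathbf{p}-\mathbf{q}\|)$ for a monotone decreasing function $f$. Let $\mu^*:=\frac1n\sum_{i}K(\mathbf{p}_i,\mathbf{q})$, let $\mu\ge\mu^*$ be a given parameter, $w_i:=K(\mathbf{p}_i,\mathbf{q})$, $J:=\lceil\log_2(1/\mu)\rceil$, and let $\epsilon$ be a precision parameter. For $j\in[J]$ define the weight levels $L_j:=\{\mathbf{p}_i\in P: w_i\in(2^{-j},2^{-j+1}]\}$, $L_{J+1}:=P\setminus\bigcup_{j\in[J]}L_j$, and the distance levels $r_j:=\max\{r: f(r)\in(2^{-j},2^{-j+1}]\}$. For $j\in[J]$ and $i\in\{j+1,\dots,J+1\}$ let $c_{i,j}:=\min\{r_{i-1}/r_j,\log^{1/7}n\}$. Define $\mathrm{cost}(K,j):=2^{\max_{i=j+1,\dots,J+1}\lceil (i-j)/(c_{i,j}^2(1-o(1)))\rceil}$ and $\mathrm{cost}(K):=\max_{j\in[J]}\mathrm{cost}(K,j)$. For each $j$, let $\mathcal{H}_j$ be the Andoni–Indyk Euclidean LSH family for near radius $r_j$ (with parameter $t=\log^{2/3}n$,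 so each evaluation takes $n^{o(1)}$ time), with near collision probability $p_{\mathrm{near},j}$ (collision probability of points at distance $\le r_j$) and with collision probability at most $p_{\mathrm{near},j}^{c^2(1-o(1))}$ for points at distance $\ge c\,r_j$, $1\le c\le\log^{1/7}n$. Let $k_j:=\frac{-1}{\log p_{\mathrm{near},j}}\max_{i=j+1,\dots,J+1}\lceil (i-j)/(c_{i,j}^2(1-o(1)))\rceil$. Preprocessing: for $K_1=\frac{C\log n}{\epsilon^2}\mu^{-o(1)}$ independent repetitions $a$ ($C$ a universal constant), for each $j\in[J]$, sample each point of $P$ independently with probability $\min\{\frac{1}{2^jn\mu},1\}$, draw $K_2=100\log n\cdot p_{\mathrm{near},j}^{-k_j}$ independent hash functions from $\mathcal{H}_j^{k_j}$ (concatenation of $k_j$ functions) and hash the sample with each, storing nonempty buckets; also store a sample of $P$ where each point is kept with probability $1/n$. Query: for each repetition $a$ and each $j$, scan the bucket of $\mathbf{q}$ under each of the $K_2$ hash functions and recover the points of $L_j$; scan the $1/n$-sample to recover points of $L_{J+1}$; for the set $S$ of recovered points output $Z_a=\sum_{\mathbf{p}_i\in S}w_i/p_i$, where $p_i=\min\{\frac{1}{2^jn\mu},1\}$ if $\mathbf{p}_i\in L_j$, $j\in[J]$, and $p_i=1/n$ if $\mathbf{p}_i\in L_{J+1}$.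
   Formalization: Assumes n^{-A} ≤ μ < 1 for a fixed A (else μ^{-o(1)} need not be n^{o(1)}), f ≥ 0, ε ≤ 1, r_j a supremum that exists and is positive, point-processing time n^{o(1)}, and the LSH facts e^{-O(√t)} ≤ p_near ≤ e^{-b}. *)

theory Defs
  imports "HOL-Probability.Probability"
begin

text \<open>
  The dimension \<open>d\<close> must be quantified after the constants hidden in the asymptotic bound,
  so the points are elements of the carrier \<^term>\<open>topspace (Euclidean_space d)\<close>.
\<close>

definition edist :: "nat \<Rightarrow> (nat \<Rightarrow> real) \<Rightarrow> (nat \<Rightarrow> real) \<Rightarrow> real" where
  "edist d x y = L2_set (\<lambda>i. x i - y i) {..<d}"

definition num_levels :: "real \<Rightarrow> nat" where
  "num_levels \<mu> = nat \<lceil>log 2 (1 / \<mu>)\<rceil>"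

definition band :: "nat \<Rightarrow> real set" where
  "band j = {2 powr (- real j) <.. 2 powr (1 - real j)}"

text \<open>
  The distance level \<open>r\<^sub>j\<close> is a supremum: since \<^term>\<open>band j\<close> is open at its lower end, the
  maximum is not attained already for continuous \<open>f\<close>.
\<close>

definition radius_set :: "(real \<Rightarrow> real) \<Rightarrow> nat \<Rightarrow> real set" where
  "radius_set f j = {r. 0 \<le> r \<and> f r \<in> band j}"

definition radius :: "(real \<Rightarrow> real) \<Rightarrow> nat \<Rightarrow> real" where
  "radius f j = Sup (radius_set f j)"

definition ratio :: "nat \<Rightarrow> (real \<Rightarrow> real) \<Rightarrow> nat \<Rightarrow> nat \<Rightarrow> real" where
  "ratio n f i j = min (radius f (i - 1) / radius f j) (log 2 (real n) powr (1 / 7))"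

text \<open>In the following, \<open>\<alpha>\<close> is the value at \<open>n\<close> of the \<open>o(1)\<close> term in \<open>c\<^sup>2(1 - o(1))\<close>.\<close>

definition cost_exponent :: "nat \<Rightarrow> real \<Rightarrow> (real \<Rightarrow> real) \<Rightarrow> real \<Rightarrow> nat \<Rightarrow> int" where
  "cost_exponent n \<alpha> f \<mu> j =
     Max ((\<lambda>i. \<lceil>(real i - real j) / ((ratio n f i j)\<^sup>2 * (1 - \<alpha>))\<rceil>) ` {j + 1..num_levels \<mu> + 1})"

definition level_cost :: "nat \<Rightarrow> real \<Rightarrow> (real \<Rightarrow> real) \<Rightarrow> real \<Rightarrow> nat \<Rightarrow> real" where
  "level_cost n \<alpha> f \<mu> j = 2 powr real_of_int (cost_exponent n \<alpha> f \<mu> j)"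

definition kernel_cost :: "nat \<Rightarrow> real \<Rightarrow> (real \<Rightarrow> real) \<Rightarrow> real \<Rightarrow> real" where
  "kernel_cost n \<alpha> f \<mu> = Max (level_cost n \<alpha> f \<mu> ` {1..num_levels \<mu>})"

text \<open>
  The guarantees of the Andoni--Indyk family on \<open>\<real>\<^sup>d\<close> for near radius \<open>r\<close> and parameter
  \<open>t = log\<^bsup>2/3\<^esup> n\<close>; the family is a probability distribution \<open>H\<close> on hash functions.
  Its near collision probability is \<open>e\<^bsup>-\<Theta>(\<surd>t)\<^esup>\<close>: the lower bound \<open>e\<^bsup>-O(\<surd>t)\<^esup>\<close> and separation
  from \<open>1\<close> are recorded, as without them the number \<open>k\<^sub>j\<close> of concatenated functions and the
  loss in rounding it to an integer would be unbounded.
  The number \<open>\<tau>\<close> bounds the time of one evaluation, and \<open>\<eta>\<close> is an \<open>o(1)\<close> term.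
\<close>

locale andoni_indyk_lsh = prob_space H
  for H :: "((nat \<Rightarrow> real) \<Rightarrow> 'b) measure" +
  fixes n d :: nat and \<alpha> \<eta> B b r p_near \<tau> :: real
  assumes collision_event:
      "\<lbrakk>x \<in> topspace (Euclidean_space d); y \<in> topspace (Euclidean_space d)\<rbrakk>
        \<Longrightarrow> {h \<in> space H. h x = h y} \<in> sets H"
    and near_collision:
      "\<lbrakk>x \<in> topspace (Euclidean_space d); y \<in> topspace (Euclidean_space d); edist d x y \<le> r\<rbrakk>
        \<Longrightarrow> p_near \<le> prob {h \<in> space H. h x = h y}"
    and far_collision:
      "\<lbrakk>x \<in> topspace (Euclidean_space d); y \<in> topspace (Euclidean_space d);
        1 \<le> c; c \<le> log 2 (real n) powr (1 / 7); c * r \<le> edist d x y\<rbrakk>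
        \<Longrightarrow> prob {h \<in> space H. h x = h y} \<le> p_near powr (c\<^sup>2 * (1 - \<alpha>))"
    and p_near_lower: "exp (- B * sqrt (log 2 (real n) powr (2 / 3))) \<le> p_near"
    and p_near_upper: "p_near \<le> exp (- b)"
    and eval_time: "0 \<le> \<tau>" "\<tau> \<le> real n powr \<eta>"

definition bernoulli_sample :: "'a set \<Rightarrow> real \<Rightarrow> 'a set pmf" where
  "bernoulli_sample P s =
     map_pmf (\<lambda>keep. {x \<in> P. keep x}) (Pi_pmf P False (\<lambda>_. bernoulli_pmf s))"

text \<open>
  An instance of the problem together with the hash families used for it. \<open>H j\<close>, \<open>p_near j\<close>
  and \<open>\<tau> j\<close> are the family for level \<open>j\<close>, its near collision probability and its evaluation
  time; \<open>\<sigma>\<close> is the time to process one stored point (read it, compute its weight and level,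
  add its contribution to the output), and also to look up a bucket.
  \<open>\<alpha>\<close>, \<open>\<beta>\<close>, \<open>\<eta>\<close> are the values at \<open>n\<close> of the \<open>o(1)\<close> terms in \<open>c\<^sup>2(1 - o(1))\<close>, in
  \<open>\<mu>\<^bsup>-o(1)\<^esup>\<close> and in the \<open>n\<^bsup>o(1)\<^esup>\<close> time bounds; \<open>A\<close> is the exponent in \<open>\<mu> = n\<^bsup>-O(1)\<^esup>\<close>, without
  which \<open>\<mu>\<^bsup>-o(1)\<^esup>\<close> is not \<open>n\<^bsup>o(1)\<^esup>\<close>.
\<close>

locale kde_instance =
  fixes A B b C :: real and \<alpha> \<beta> \<eta> :: real
    and n d :: nat and P :: "(nat \<Rightarrow> real) set" and q :: "nat \<Rightarrow> real"
    and f :: "real \<Rightarrow> real" and \<mu> \<epsilon> :: real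
    and H :: "nat \<Rightarrow> ((nat \<Rightarrow> real) \<Rightarrow> 'b) measure" and p_near \<tau> :: "nat \<Rightarrow> real" and \<sigma> :: real
  assumes points: "P \<subseteq> topspace (Euclidean_space d)" "finite P" "card P = n"
    and query_point: "q \<in> topspace (Euclidean_space d)"
    and kernel_nonneg: "\<And>x. 0 \<le> x \<Longrightarrow> 0 \<le> f x"
    and kernel_decreasing: "antimono_on {0..} f"
    and density_le: "(\<Sum>x\<in>P. f (edist d x q)) / real n \<le> \<mu>"
    and density_range: "real n powr (- A) \<le> \<mu>" "\<mu> < 1"
    and precision: "0 < \<epsilon>" "\<epsilon> \<le> 1"
    and radius_defined:
      "\<And>j. j \<in> {1..num_levels \<mu>} \<Longrightarrow> radius_set f j \<noteq> {}"
      "\<And>j. j \<in> {1..num_levels \<mu>} \<Longrightarrow> bdd_above (radius_set f j)"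
      "\<And>j. j \<in> {1..num_levels \<mu>} \<Longrightarrow> 0 < radius f j"
    and lsh: "\<And>j. j \<in> {1..num_levels \<mu>} \<Longrightarrow>
      andoni_indyk_lsh (H j) n d \<alpha> \<eta> B b (radius f j) (p_near j) (\<tau> j)"
    and point_time: "0 \<le> \<sigma>" "\<sigma> \<le> real n powr \<eta>"
begin

definition weight :: "(nat \<Rightarrow> real) \<Rightarrow> real" where
  "weight x = f (edist d x q)"

definition level :: "nat \<Rightarrow> (nat \<Rightarrow> real) set" where
  "level j = {x \<in> P. weight x \<in> band j}"

definition last_level :: "(nat \<Rightarrow> real) set" where
  "last_level = P - (\<Union>j\<in>{1..num_levels \<mu>}. level j)"

definition sample_prob :: "nat \<Rightarrow> real" where
  "sample_prob j = min (1 / (2 ^ j * real n * \<mu>)) 1"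

text \<open>The numbers \<open>k\<^sub>j\<close>, \<open>K\<^sub>1\<close> and \<open>K\<^sub>2\<close> are rounded up to integers.\<close>

definition concat_len :: "nat \<Rightarrow> nat" where
  "concat_len j =
     nat \<lceil>- 1 / log 2 (p_near j) * real_of_int (cost_exponent n \<alpha> f \<mu> j)\<rceil>"

definition num_reps :: nat where
  "num_reps = nat \<lceil>C * log 2 (real n) / \<epsilon>\<^sup>2 * \<mu> powr (- \<beta>)\<rceil>"

definition num_tables :: "nat \<Rightarrow> nat" where
  "num_tables j = nat \<lceil>100 * log 2 (real n) * p_near j powr (- real (concat_len j))\<rceil>"

text \<open>
  The random choices of the preprocessing. For repetition \<open>a\<close>, the component \<open>fst (\<omega> a) j\<close> is the
  sample for level \<open>j\<close> together with the hash functions indexed by \<open>(l, m)\<close>, the \<open>m\<close>-th of the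
  functions concatenated for table \<open>l\<close>; the component \<open>snd (\<omega> a)\<close> is the sample with rate \<open>1/n\<close>.
\<close>

definition level_space ::
    "nat \<Rightarrow> ((nat \<Rightarrow> real) set \<times> (nat \<times> nat \<Rightarrow> (nat \<Rightarrow> real) \<Rightarrow> 'b)) measure" where
  "level_space j = measure_pmf (bernoulli_sample P (sample_prob j))
     \<Otimes>\<^sub>M (\<Pi>\<^sub>M lm\<in>{..<num_tables j} \<times> {..<concat_len j}. H j)"

definition preprocessing_space ::
    "(nat \<Rightarrow> (nat \<Rightarrow> (nat \<Rightarrow> real) set \<times> (nat \<times> nat \<Rightarrow> (nat \<Rightarrow> real) \<Rightarrow> 'b))
       \<times> (nat \<Rightarrow> real) set) measure" where
  "preprocessing_space =
     (\<Pi>\<^sub>M a\<in>{..<num_reps}. (\<Pi>\<^sub>M j\<in>{1..num_levels \<mu>}. level_space j)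
        \<Otimes>\<^sub>M measure_pmf (bernoulli_sample P (1 / real n)))"

text \<open>
  The samples are almost surely subsets of \<open>P\<close>; repeating \<open>x \<in> P\<close> here keeps the bucket size
  measurable on the whole product space.
\<close>

definition bucket ::
    "nat \<Rightarrow> (nat \<Rightarrow> real) set \<times> (nat \<times> nat \<Rightarrow> (nat \<Rightarrow> real) \<Rightarrow> 'b) \<Rightarrow> nat \<Rightarrow> (nat \<Rightarrow> real) set" where
  "bucket j D l = {x \<in> P. x \<in> fst D \<and> (\<forall>m<concat_len j. snd D (l, m) x = snd D (l, m) q)}"

definition recovered ::
    "(nat \<Rightarrow> (nat \<Rightarrow> real) set \<times> (nat \<times> nat \<Rightarrow> (nat \<Rightarrow> real) \<Rightarrow> 'b)) \<times> (nat \<Rightarrow> real) set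
       \<Rightarrow> (nat \<Rightarrow> real) set" where
  "recovered R = (\<Union>j\<in>{1..num_levels \<mu>}. \<Union>l<num_tables j. bucket j (fst R j) l \<inter> level j)
     \<union> (snd R \<inter> last_level)"

definition estimate ::
    "(nat \<Rightarrow> (nat \<Rightarrow> real) set \<times> (nat \<times> nat \<Rightarrow> (nat \<Rightarrow> real) \<Rightarrow> 'b)) \<times> (nat \<Rightarrow> real) set
       \<Rightarrow> real" where
  "estimate R =
     (\<Sum>j\<in>{1..num_levels \<mu>}. \<Sum>x\<in>recovered R \<inter> level j. weight x / sample_prob j)
     + (\<Sum>x\<in>recovered R \<inter> last_level. weight x / (1 / real n))"

definition rep_time ::
    "(nat \<Rightarrow> (nat \<Rightarrow> real) set \<times> (nat \<times> nat \<Rightarrow> (nat \<Rightarrow> real) \<Rightarrow> 'b)) \<times> (nat \<Rightarrow> real) set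
       \<Rightarrow> real" where
  "rep_time R =
     (\<Sum>j\<in>{1..num_levels \<mu>}. \<Sum>l<num_tables j.
        real (concat_len j) * \<tau> j + (1 + real (card (bucket j (fst R j) l))) * \<sigma>)
     + real (card (snd R)) * \<sigma> + real (card (recovered R)) * \<sigma>"

text \<open>The outputs \<open>Z\<^sub>a\<close> of the query, and its running time.\<close>

definition query ::
    "(nat \<Rightarrow> (nat \<Rightarrow> (nat \<Rightarrow> real) set \<times> (nat \<times> nat \<Rightarrow> (nat \<Rightarrow> real) \<Rightarrow> 'b))
       \<times> (nat \<Rightarrow> real) set) \<Rightarrow> real list \<times> real" where
  "query \<omega> = (map (\<lambda>a. estimate (\<omega> a)) [0..<num_reps], \<Sum>a<num_reps. rep_time (\<omega> a))"

definition query_time ::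
    "(nat \<Rightarrow> (nat \<Rightarrow> (nat \<Rightarrow> real) set \<times> (nat \<times> nat \<Rightarrow> (nat \<Rightarrow> real) \<Rightarrow> 'b))
       \<times> (nat \<Rightarrow> real) set) \<Rightarrow> real" where
  "query_time \<omega> = snd (query \<omega>)"

end

end

theory Submission
  imports Defs "HOL-Real_Asymp.Real_Asymp"
begin

text \<open>
  Fix a level \<open>j\<close> and group the points by weight class \<open>i\<close>. As the weights sum to at most \<open>n\<mu>\<close>,
  class \<open>i\<close> has at most \<open>2\<^sup>i n\<mu>\<close> points, so about \<open>2\<^bsup>i-j\<^esup>\<close> of them survive the sampling. For \<open>i > j\<close>
  they lie beyond \<open>r\<^bsub>i-1\<^esub> \<ge> c\<^bsub>i,j\<^esub> r\<^sub>j\<close>, and \<open>k\<^sub>j\<close> is chosen so that they collide with the query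
  under all \<open>k\<^sub>j\<close> functions with probability at most \<open>2\<^bsup>-(i-j)\<^esup>\<close>. Hence a bucket holds at most \<open>J + 1\<close>
  points in expectation, and the time is governed by the number of tables
  \<open>p\<^bsup>-k\<^esup> \<le> cost / p\<close>, where rounding \<open>k\<^sub>j\<close> up loses only the factor \<open>1 / p = n\<^bsup>o(1)\<^esup>\<close>.
\<close>

section \<open>Marginals of product spaces\<close>

text \<open>The preimage of \<open>X\<close> under \<open>snd\<close> is a rectangle whose first
  side is all of \<open>space M\<close>, of measure 1.\<close>

lemma distr_pair_snd_prob:
  assumes "prob_space M" and "prob_space N"
  shows "distr (M \<Otimes>\<^sub>M N) N snd = N"
proof (intro measure_eqI)
  interpret M: prob_space M by fact
  interpret N: prob_space N by fact
  fix X assume X: "X \<in> sets (distr (M \<Otimes>\<^sub>M N) N snd)"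
  then have "emeasure (distr (M \<Otimes>\<^sub>M N) N snd) X = emeasure (M \<Otimes>\<^sub>M N) (space M \<times> X)"
    by (auto simp: emeasure_distr space_pair_measure dest: sets.sets_into_space
        intro!: arg_cong2[where f = emeasure])
  with X show "emeasure (distr (M \<Otimes>\<^sub>M N) N snd) X = emeasure N X"
    by (simp add: N.emeasure_pair_measure_Times M.emeasure_space_1)
qed simp

text \<open>Every bucket size and sample size depends on one coordinate of the preprocessing.
  Applied to product components and pair projections, this rule lets its expectation be computed on
  that coordinate alone.\<close>

lemma integral_marginal:
  fixes g :: "'b \<Rightarrow> real"
  assumes T: "T \<in> measurable M N" and D: "distr M N T = N" and g: "integrable N g"
  shows "integrable M (\<lambda>x. g (T x))" and "(\<integral>x. g (T x) \<partial>M) = (\<integral>y. g y \<partial>N)"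
proof -
  show "integrable M (\<lambda>x. g (T x))"
    using g integrable_distr[OF T] by (simp add: D)
  show "(\<integral>x. g (T x) \<partial>M) = (\<integral>y. g y \<partial>N)"
    using integral_distr[OF T borel_measurable_integrable[OF g]] by (simp add: D)
qed

lemma integral_PiM_component:
  fixes g :: "'b \<Rightarrow> real"
  assumes "\<And>i. i \<in> I \<Longrightarrow> prob_space (M i)" "i \<in> I" "integrable (M i) g"
  shows "integrable (Pi\<^sub>M I M) (\<lambda>x. g (x i))"
    and "(\<integral>x. g (x i) \<partial>Pi\<^sub>M I M) = (\<integral>y. g y \<partial>M i)"
proof -
  have "distr (Pi\<^sub>M I M) (M i) (\<lambda>x. x i) = M i"
    by (rule distr_PiM_component) (use assms in auto)
  note marginal = integral_marginal[OF measurable_component_singleton[OF assms(2)] this assms(3)]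
  show "integrable (Pi\<^sub>M I M) (\<lambda>x. g (x i))" by (rule marginal)
  show "(\<integral>x. g (x i) \<partial>Pi\<^sub>M I M) = (\<integral>y. g y \<partial>M i)" by (rule marginal)
qed

text \<open>\<open>T\<close> depends on the outer index because the number of tables varies with the
  level.\<close>

lemma integral_double_sum:
  fixes g :: "'i \<Rightarrow> 'j \<Rightarrow> 'a \<Rightarrow> real"
  assumes "\<And>i j. i \<in> S \<Longrightarrow> j \<in> T i \<Longrightarrow> integrable M (g i j)"
  shows "integrable M (\<lambda>x. \<Sum>i\<in>S. \<Sum>j\<in>T i. g i j x)"
    and "(\<integral>x. (\<Sum>i\<in>S. \<Sum>j\<in>T i. g i j x) \<partial>M) = (\<Sum>i\<in>S. \<Sum>j\<in>T i. \<integral>x. g i j x \<partial>M)"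
proof -
  have int: "integrable M (\<lambda>x. \<Sum>j\<in>T i. g i j x)" if "i \<in> S" for i
    by (rule Bochner_Integration.integrable_sum) (rule assms[OF that])
  then show "integrable M (\<lambda>x. \<Sum>i\<in>S. \<Sum>j\<in>T i. g i j x)"
    by (rule Bochner_Integration.integrable_sum)
  have "(\<integral>x. (\<Sum>i\<in>S. \<Sum>j\<in>T i. g i j x) \<partial>M) = (\<Sum>i\<in>S. \<integral>x. (\<Sum>j\<in>T i. g i j x) \<partial>M)"
    by (rule Bochner_Integration.integral_sum) (rule int)
  also have "\<dots> = (\<Sum>i\<in>S. \<Sum>j\<in>T i. \<integral>x. g i j x \<partial>M)"
    by (intro sum.cong refl Bochner_Integration.integral_sum assms)
  finally show "(\<integral>x. (\<Sum>i\<in>S. \<Sum>j\<in>T i. g i j x) \<partial>M) = (\<Sum>i\<in>S. \<Sum>j\<in>T i. \<integral>x. g i j x \<partial>M)" .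
qed

lemma integral_pair_fst:
  fixes g :: "'a \<Rightarrow> real"
  assumes "prob_space N" "integrable M g"
  shows "integrable (M \<Otimes>\<^sub>M N) (\<lambda>x. g (fst x))"
    and "(\<integral>x. g (fst x) \<partial>(M \<Otimes>\<^sub>M N)) = (\<integral>y. g y \<partial>M)"
  using integral_marginal[OF measurable_fst prob_space.distr_pair_fst[OF assms(1)] assms(2)] by auto

lemma integral_pair_snd:
  fixes g :: "'b \<Rightarrow> real"
  assumes "prob_space M" "prob_space N" "integrable N g"
  shows "integrable (M \<Otimes>\<^sub>M N) (\<lambda>x. g (snd x))"
    and "(\<integral>x. g (snd x) \<partial>(M \<Otimes>\<^sub>M N)) = (\<integral>y. g y \<partial>N)"
  using integral_marginal[OF measurable_snd distr_pair_snd_prob[OF assms(1,2)] assms(3)] by auto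

section \<open>Bernoulli samples\<close>

lemma prob_mem_bernoulli_sample:
  assumes "finite P" "x \<in> P" "0 \<le> s" "s \<le> 1"
  shows "measure_pmf.prob (bernoulli_sample P s) {S. x \<in> S} = s"
proof -
  have "measure_pmf.prob (bernoulli_sample P s) {S. x \<in> S}
      = measure_pmf.prob (map_pmf (\<lambda>g. g x) (Pi_pmf P False (\<lambda>_. bernoulli_pmf s))) {True}"
    using assms by (simp add: bernoulli_sample_def vimage_def)
  also have "\<dots> = s"
    using assms by (simp add: Pi_pmf_component measure_pmf_single)
  finally show ?thesis .
qed

lemma set_bernoulli_sample: "set_pmf (bernoulli_sample P s) \<subseteq> Pow P"
  by (auto simp: bernoulli_sample_def)

lemma expectation_card_bernoulli_sample:
  assumes "finite P" "0 \<le> s" "s \<le> 1"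
  shows "integrable (bernoulli_sample P s) (\<lambda>S. real (card S))"
    and "measure_pmf.expectation (bernoulli_sample P s) (\<lambda>S. real (card S)) = real (card P) * s"
proof -
  have fin: "finite (set_pmf (bernoulli_sample P s))"
    using set_bernoulli_sample assms(1) by (rule finite_subset[OF _ finite_Pow_iff[THEN iffD2]])
  then show "integrable (bernoulli_sample P s) (\<lambda>S. real (card S))"
    by (rule integrable_measure_pmf_finite)
  have "measure_pmf.expectation (bernoulli_sample P s) (\<lambda>S. real (card S))
      = measure_pmf.expectation (bernoulli_sample P s) (\<lambda>S. \<Sum>x\<in>P. indicator {S. x \<in> S} S)"
  \<comment> \<open>Both sides agree for subsets of \<open>P\<close>, hence on the support of the
    sample, but not for arbitrary sets.\<close>
  proof (rule integral_cong_AE)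
    show "AE S in bernoulli_sample P s. real (card S) = (\<Sum>x\<in>P. indicator {S. x \<in> S} S)"
    proof (rule AE_pmfI)
      fix S assume "S \<in> set_pmf (bernoulli_sample P s)"
      then have "S \<subseteq> P" using set_bernoulli_sample by blast
      then have "(\<Sum>x\<in>P. indicator {S. x \<in> S} S) = (\<Sum>x\<in>S. 1 :: real)"
        using assms(1) by (intro sum.mono_neutral_cong_right) auto
      then show "real (card S) = (\<Sum>x\<in>P. indicator {S. x \<in> S} S)" by simp
    qed
  qed auto
  also have "\<dots> = (\<Sum>x\<in>P. measure_pmf.prob (bernoulli_sample P s) {S. x \<in> S})"
    by (subst Bochner_Integration.integral_sum) (auto intro!: integrable_measure_pmf_finite fin)
  also have "\<dots> = real (card P) * s"
    using prob_mem_bernoulli_sample[OF assms(1) _ assms(2,3)] by simp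
  finally show "measure_pmf.expectation (bernoulli_sample P s) (\<lambda>S. real (card S)) = real (card P) * s" .
qed

section \<open>Levels and costs\<close>

context kde_instance
begin

abbreviation J :: nat where "J \<equiv> num_levels \<mu>"

abbreviation collision_prob :: "nat \<Rightarrow> (nat \<Rightarrow> real) \<Rightarrow> real" where
  "collision_prob j x \<equiv> measure (H j) {h \<in> space (H j). h x = h q}"

section \<open>Range of \<mu> and the number of levels\<close>

lemma mu_pos: "0 < n \<Longrightarrow> 0 < \<mu>"
  using density_range(1) powr_gt_zero[of "real n" "-A"] by linarith

lemma num_levels_pos:
  assumes "0 < n" shows "1 \<le> J"
proof -
  have "0 < log 2 (1 / \<mu>)" using mu_pos[OF assms] density_range by simp
  then have "0 < \<lceil>log 2 (1 / \<mu>)\<rceil>" by linarith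
  then show ?thesis unfolding num_levels_def by linarith
qed

text \<open>This brings the trivial bound \<open>n\<close> on the size of the lightest weight class
  below \<open>2 powr i * (n * \<mu>)\<close> for \<open>i = J + 1\<close>.\<close>

lemma num_levels_ge:
  assumes "0 < n" shows "1 / \<mu> \<le> 2 powr real J"
proof -
  have "log 2 (1 / \<mu>) \<le> real J" by (simp add: num_levels_def) linarith
  then have "2 powr log 2 (1 / \<mu>) \<le> 2 powr real J" by simp
  then show ?thesis using mu_pos[OF assms] by simp
qed

text \<open>The polynomial lower bound on \<mu> controls the logarithm; the extra 1 in the constant
  pays for the ceiling, as \<open>log 2 n \<ge> 1\<close>.\<close>

lemma num_levels_le:
  assumes "2 \<le> n" shows "real J \<le> (\<bar>A\<bar> + 1) * log 2 (real n)"
proof -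
  have "log 2 (1 / \<mu>) \<le> log 2 (real n powr A)"
    using density_range(1) mu_pos assms
    by (intro log_mono) (auto simp: powr_minus field_simps)
  then have "log 2 (1 / \<mu>) \<le> A * log 2 (real n)" using assms by (simp add: log_powr)
  also have "\<dots> \<le> \<bar>A\<bar> * log 2 (real n)" using assms by (intro mult_right_mono) auto
  finally have "log 2 (1 / \<mu>) \<le> \<bar>A\<bar> * log 2 (real n)" .
  moreover have "0 < log 2 (1 / \<mu>)" using mu_pos assms density_range by simp
  moreover have "1 \<le> log 2 (real n)" using assms by simp
  moreover have "real J \<le> log 2 (1 / \<mu>) + 1"
    using \<open>0 < log 2 (1 / \<mu>)\<close> unfolding num_levels_def by linarith
  ultimately show ?thesis by (simp add: distrib_right)
qed

text \<open>Every \<open>r\<close> in \<open>radius_set f j\<close> has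
  \<open>f r > 2 powr (- j) \<ge> f x\<close>, so antitonicity excludes \<open>r > x\<close>. This
  converts a small weight into a large distance.\<close>

lemma radius_le:
  assumes j: "j \<in> {1..J}" and x: "0 \<le> x" "f x \<le> 2 powr (- real j)"
  shows "radius f j \<le> x"
  unfolding radius_def
proof (rule cSup_least)
  show "radius_set f j \<noteq> {}" using radius_defined(1)[OF j] .
  fix r assume "r \<in> radius_set f j"
  then have r: "0 \<le> r" "f x < f r" using x by (auto simp: radius_set_def band_def)
  show "r \<le> x"
  proof (rule ccontr)
    assume "\<not> r \<le> x"
    then have "f r \<le> f x"
      using kernel_decreasing x r by (auto simp: monotone_on_def)
    then show False using r by simp
  qed
qed

text \<open>For \<open>j < i\<close>, any member of \<open>radius_set f i\<close> has kernel value
  at most \<open>2 powr (1 - i) \<le> 2 powr (- j)\<close>, so \<open>radius_le\<close> applies to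
  it.\<close>

lemma radius_mono:
  assumes "j \<in> {1..J}" "i \<in> {1..J}" "j \<le> i"
  shows "radius f j \<le> radius f i"
proof (cases "i = j")
  case False
  obtain x where x: "x \<in> radius_set f i" using radius_defined(1)[OF assms(2)] by blast
  have "2 powr (1 - real i) \<le> 2 powr (- real j)" using False assms by simp
  moreover have "0 \<le> x" "f x \<le> 2 powr (1 - real i)" using x by (auto simp: radius_set_def band_def)
  ultimately have "0 \<le> x" "f x \<le> 2 powr (- real j)" by linarith+
  then have "radius f j \<le> x" by (rule radius_le[OF assms(1)])
  also have "x \<le> radius f i"
    unfolding radius_def by (rule cSup_upper[OF x radius_defined(2)[OF assms(2)]])
  finally show ?thesis .
qed simp

text \<open>Supplies the condition \<open>1 \<le> c\<close> of the far collision bound and keeps the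
  denominators in the cost positive.\<close>

lemma ratio_ge_1:
  assumes "2 \<le> n" "j \<in> {1..J}" "i \<in> {j + 1..J + 1}"
  shows "1 \<le> ratio n f i j"
proof -
  have "radius f j \<le> radius f (i - 1)" using assms by (intro radius_mono) auto
  then have "1 \<le> radius f (i - 1) / radius f j"
    using radius_defined(3)[OF assms(2)] by simp
  moreover have "1 \<le> log 2 (real n) powr (1 / 7)"
    using assms(1) by (intro ge_one_powr_ge_zero) auto
  ultimately show ?thesis by (simp add: ratio_def)
qed

text \<open>Clearing the positive denominator puts the maximum into the form in which it meets the
  exponent \<open>c\<^sup>2 * (1 - \<alpha>)\<close> of the far collision bound.\<close>

lemma cost_exponent_ge:
  assumes "2 \<le> n" "\<alpha> < 1" "j \<in> {1..J}" "i \<in> {j + 1..J + 1}"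
  shows "real i - real j
    \<le> (ratio n f i j)\<^sup>2 * (1 - \<alpha>) * real_of_int (cost_exponent n \<alpha> f \<mu> j)"
proof -
  have "\<lceil>(real i - real j) / ((ratio n f i j)\<^sup>2 * (1 - \<alpha>))\<rceil> \<le> cost_exponent n \<alpha> f \<mu> j"
    unfolding cost_exponent_def using assms by (intro Max_ge) auto
  then have "(real i - real j) / ((ratio n f i j)\<^sup>2 * (1 - \<alpha>))
      \<le> real_of_int (cost_exponent n \<alpha> f \<mu> j)" by linarith
  moreover have "0 < (ratio n f i j)\<^sup>2 * (1 - \<alpha>)"
    using ratio_ge_1[OF assms(1,3,4)] assms(2) by (auto intro!: mult_pos_pos)
  ultimately show ?thesis by (simp add: field_simps)
qed

lemma cost_exponent_nonneg:
  assumes "2 \<le> n" "\<alpha> < 1" "j \<in> {1..J}"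
  shows "0 \<le> cost_exponent n \<alpha> f \<mu> j"
proof -
  \<comment> \<open>The term \<open>i = j + 1\<close> has numerator 1 and alone forces the exponent
    to be positive.\<close>
  have i: "j + 1 \<in> {j + 1..J + 1}" using assms by auto
  have "0 < (ratio n f (j + 1) j)\<^sup>2 * (1 - \<alpha>)"
    using ratio_ge_1[OF assms(1,3) i] assms(2) by (auto intro!: mult_pos_pos)
  moreover have "0 < (ratio n f (j + 1) j)\<^sup>2 * (1 - \<alpha>) * real_of_int (cost_exponent n \<alpha> f \<mu> j)"
    using cost_exponent_ge[OF assms i] by linarith
  ultimately have "0 < real_of_int (cost_exponent n \<alpha> f \<mu> j)" using zero_less_mult_pos by blast
  then show ?thesis by simp
qed

text \<open>Each denominator is at least \<open>1 / 2\<close>, and \<open>i - j \<le> J\<close>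
  because \<open>j \<ge> 1\<close>. This later makes the number of concatenated functions
  logarithmic in \<open>n\<close>.\<close>

lemma cost_exponent_le:
  assumes "2 \<le> n" "\<alpha> \<le> 1 / 2" "j \<in> {1..J}"
  shows "cost_exponent n \<alpha> f \<mu> j \<le> 2 * int J"
proof -
  have "\<lceil>(real i - real j) / ((ratio n f i j)\<^sup>2 * (1 - \<alpha>))\<rceil> \<le> 2 * int J"
    if i: "i \<in> {j + 1..J + 1}" for i
  proof -
    have "1 \<le> (ratio n f i j)\<^sup>2" using ratio_ge_1[OF assms(1,3) i] by simp
    then have "1 / 2 \<le> (ratio n f i j)\<^sup>2 * (1 - \<alpha>)"
      using mult_mono[of 1 "(ratio n f i j)\<^sup>2" "1 / 2" "1 - \<alpha>"] assms by simp
    then have "(real i - real j) / ((ratio n f i j)\<^sup>2 * (1 - \<alpha>)) \<le> (real i - real j) / (1 / 2)"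
      using i by (intro divide_left_mono) auto
    also have "\<dots> \<le> 2 * real J" using i assms(3) by simp
    finally show ?thesis by linarith
  qed
  then show ?thesis unfolding cost_exponent_def using assms by (subst Max_le_iff) auto
qed

lemma level_cost_le_kernel_cost:
  "j \<in> {1..J} \<Longrightarrow> level_cost n \<alpha> f \<mu> j \<le> kernel_cost n \<alpha> f \<mu>"
  unfolding kernel_cost_def by (intro Max_ge) auto

lemma kernel_cost_ge_1:
  assumes "2 \<le> n" "\<alpha> < 1" shows "1 \<le> kernel_cost n \<alpha> f \<mu>"
proof -
  have j: "1 \<in> {1..J}" using num_levels_pos assms by auto
  have "1 \<le> level_cost n \<alpha> f \<mu> 1"
    unfolding level_cost_def using cost_exponent_nonneg[OF assms j] by (intro ge_one_powr_ge_zero) auto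
  also have "\<dots> \<le> kernel_cost n \<alpha> f \<mu>" by (rule level_cost_le_kernel_cost[OF j])
  finally show ?thesis .
qed

section \<open>Collision probabilities\<close>

lemma p_near_bounds:
  assumes "j \<in> {1..J}"
  shows "0 < p_near j" "exp (- B * sqrt (log 2 (real n) powr (2 / 3))) \<le> p_near j"
    "p_near j \<le> exp (- b)"
proof -
  interpret andoni_indyk_lsh "H j" n d \<alpha> \<eta> B b "radius f j" "p_near j" "\<tau> j"
    by (rule lsh[OF assms])
  show "exp (- B * sqrt (log 2 (real n) powr (2 / 3))) \<le> p_near j" by (rule p_near_lower)
  then show "0 < p_near j" using exp_gt_zero less_le_trans by blast
  show "p_near j \<le> exp (- b)" by (rule p_near_upper)
qed

text \<open>The right-hand side is \<open>- ln (p_near j)\<close>. Being bounded away from 0, it is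
  safe to divide by in \<open>concat_len\<close>.\<close>

lemma log_p_near:
  assumes "j \<in> {1..J}"
  shows "b \<le> ln 2 * - log 2 (p_near j)"
proof -
  have "ln (p_near j) \<le> ln (exp (- b))"
    using p_near_bounds[OF assms] by (subst ln_le_cancel_iff) auto
  then show ?thesis by (simp add: log_def)
qed

text \<open>With \<open>l = - log 2 (p_near j)\<close> and cost exponent \<open>E\<close>, the
  length is the ceiling of \<open>E / l\<close>. The lower bound makes far points collide rarely;
  the upper bound limits the number of tables, its extra \<open>l\<close> being the price of
  rounding.\<close>

lemma concat_len_bounds:
  assumes "0 < b" "2 \<le> n" "\<alpha> < 1" "j \<in> {1..J}"
  shows "real_of_int (cost_exponent n \<alpha> f \<mu> j) \<le> real (concat_len j) * - log 2 (p_near j)"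
    and "real (concat_len j) * - log 2 (p_near j)
      \<le> real_of_int (cost_exponent n \<alpha> f \<mu> j) - log 2 (p_near j)"
proof -
  define l where "l = - log 2 (p_near j)"
  define E where "E = real_of_int (cost_exponent n \<alpha> f \<mu> j)"
  have "0 < ln 2 * l" using log_p_near[OF assms(4)] assms(1) unfolding l_def by linarith
  then have l: "0 < l" by (simp add: zero_less_mult_iff)
  have E: "0 \<le> E" using cost_exponent_nonneg[OF assms(2-4)] by (simp add: E_def)
  have k: "concat_len j = nat \<lceil>E / l\<rceil>" by (simp add: concat_len_def l_def E_def)
  have "0 \<le> E / l" using E l by simp
  then have "E / l \<le> real (concat_len j)" "real (concat_len j) \<le> E / l + 1"
    unfolding k by linarith+
  then have "E \<le> real (concat_len j) * l" "real (concat_len j) * l \<le> E + l"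
    using l by (auto simp: field_simps)
  then show "E \<le> real (concat_len j) * - log 2 (p_near j)"
    "real (concat_len j) * - log 2 (p_near j) \<le> E - log 2 (p_near j)"
    by (auto simp: l_def)
qed

text \<open>The point lies at distance at least
  \<open>radius f (i - 1) \<ge> c * radius f j\<close>, so the far collision bound applies to a
  single function. For \<open>k\<close> functions the base 2 logarithm of the bound is
  \<open>- c\<^sup>2 * (1 - \<alpha>) * k * l\<close> with \<open>k * l \<ge> E\<close>, and
  \<open>E\<close> dominates \<open>(i - j) / (c\<^sup>2 * (1 - \<alpha>))\<close>.\<close>

lemma collision_prob_power_le:
  assumes "0 < b" "2 \<le> n" "\<alpha> < 1" "j \<in> {1..J}" "i \<in> {j + 1..J + 1}"
    and x: "x \<in> P" "weight x \<le> 2 powr (1 - real i)"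
  shows "collision_prob j x ^ concat_len j \<le> 2 powr (real j - real i)"
proof -
  interpret andoni_indyk_lsh "H j" n d \<alpha> \<eta> B b "radius f j" "p_near j" "\<tau> j"
    by (rule lsh[OF assms(4)])
  define c where "c = ratio n f i j"
  note p = p_near_bounds(1)[OF assms(4)]
  \<comment> \<open>Level \<open>i - 1\<close> fits because its lower edge is exactly the assumed
    bound \<open>2 powr (1 - i)\<close> on the weight.\<close>
  have "radius f (i - 1) \<le> edist d x q"
    using x assms by (intro radius_le) (auto simp: weight_def edist_def L2_set_nonneg of_nat_diff)
  moreover have "c * radius f j \<le> radius f (i - 1)"
    using radius_defined(3)[OF assms(4)] by (simp add: c_def ratio_def flip: pos_le_divide_eq)
  ultimately have "collision_prob j x \<le> p_near j powr (c\<^sup>2 * (1 - \<alpha>))"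
    using points query_point x(1) ratio_ge_1[OF assms(2,4,5)]
    by (intro far_collision) (auto simp: c_def ratio_def)
  then have "collision_prob j x ^ concat_len j
      \<le> (p_near j powr (c\<^sup>2 * (1 - \<alpha>))) ^ concat_len j"
    by (intro power_mono) auto
  also have "\<dots> = (2 powr (log 2 (p_near j))) powr (c\<^sup>2 * (1 - \<alpha>) * real (concat_len j))"
    using p by (simp add: powr_powr flip: powr_realpow)
  also have "\<dots> = 2 powr (- (c\<^sup>2 * (1 - \<alpha>) * (real (concat_len j) * - log 2 (p_near j))))"
    by (simp only: powr_powr) (simp add: mult_ac)
  also have "\<dots> \<le> 2 powr (real j - real i)"
  proof -
    have "real i - real j \<le> c\<^sup>2 * (1 - \<alpha>) * real_of_int (cost_exponent n \<alpha> f \<mu> j)"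
      using cost_exponent_ge[OF assms(2-5)] by (simp add: c_def)
    also have "\<dots> \<le> c\<^sup>2 * (1 - \<alpha>) * (real (concat_len j) * - log 2 (p_near j))"
      using concat_len_bounds(1)[OF assms(1-4)] assms(3) by (intro mult_left_mono) auto
    finally show ?thesis by simp
  qed
  finally show ?thesis .
qed

text \<open>Markov's inequality for counting: the weights sum to at most \<open>n * \<mu>\<close>,
  and each point of \<open>Q\<close> contributes at least \<open>2 powr (- i)\<close>.\<close>

lemma card_heavy_le:
  assumes "2 \<le> n" and Q: "Q \<subseteq> P" "\<And>x. x \<in> Q \<Longrightarrow> 2 powr (- real i) \<le> weight x"
  shows "real (card Q) \<le> 2 powr real i * (real n * \<mu>)"
proof -
  have "real (card Q) * 2 powr (- real i) \<le> (\<Sum>x\<in>Q. weight x)"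
    using Q(2) sum_mono[of Q "\<lambda>_. 2 powr (- real i)" weight] by simp
  also have "\<dots> \<le> (\<Sum>x\<in>P. weight x)"
    using Q points by (intro sum_mono2) (auto simp: weight_def edist_def L2_set_nonneg kernel_nonneg)
  also have "\<dots> \<le> real n * \<mu>"
    using density_le assms(1) by (simp add: weight_def field_simps)
  finally show ?thesis by (simp add: powr_minus field_simps)
qed

lemma sample_prob_bounds:
  assumes "2 \<le> n"
  shows "0 \<le> sample_prob j" "sample_prob j \<le> 1" "sample_prob j \<le> 1 / (2 powr real j * (real n * \<mu>))"
  using mu_pos assms by (auto simp: sample_prob_def powr_realpow mult_ac)

text \<open>In class \<open>i\<close> the bounds for size, sampling rate and collision probability
  are \<open>2 powr i * (n * \<mu>)\<close>, \<open>1 / (2 powr j * (n * \<mu>))\<close> and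
  \<open>2 powr (j - i)\<close>. Their product is 1, so it remains to count classes.\<close>

lemma expected_bucket_le:
  assumes "0 < b" "2 \<le> n" "\<alpha> < 1" "j \<in> {1..J}"
  shows "(\<Sum>x\<in>P. sample_prob j * collision_prob j x ^ concat_len j) \<le> real J + 1"
proof -
  interpret andoni_indyk_lsh "H j" n d \<alpha> \<eta> B b "radius f j" "p_near j" "\<tau> j"
    by (rule lsh[OF assms(4)])
  define g where "g x = sample_prob j * collision_prob j x ^ concat_len j" for x
  \<comment> \<open>The classes differ from the weight levels. The default class \<open>j\<close>
    collects all weights above \<open>2 powr (- j)\<close>, including those heavier than level
    \<open>j\<close>; class \<open>J + 1\<close> collects all weights up to
    \<open>2 powr (- J)\<close>.\<close>
  define V where "V x = {i \<in> {j + 1..J + 1}. weight x \<le> 2 powr (1 - real i)}" for x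
  define cls where "cls x = Max (insert j (V x))" for x
  have finV: "finite (V x)" for x by (simp add: V_def)
  have cls_mem: "cls x \<in> insert j (V x)" for x
    unfolding cls_def using finV by (intro Max_in) auto
  have cls_ge: "i \<in> V x \<Longrightarrow> i \<le> cls x" for i x
    unfolding cls_def using finV by (intro Max_ge) auto
  have cls_range: "cls x \<in> {j..J + 1}" for x
    using cls_mem[of x] assms(4) by (auto simp: V_def)
  note mu = mu_pos
  have N: "0 < real n * \<mu>" using mu assms(2) by simp
  have class_bound: "(\<Sum>x\<in>{x\<in>P. cls x = i}. g x) \<le> 1" if i: "i \<in> {j..J + 1}" for i
  proof -
    let ?Q = "{x\<in>P. cls x = i}"
    \<comment> \<open>In class \<open>j\<close> the claimed bound is 1, which holds for any
      probability.\<close>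
    have coll: "collision_prob j x ^ concat_len j \<le> 2 powr (real j - real i)" if "x \<in> ?Q" for x
    proof (cases "i = j")
      case True
      then show ?thesis by (simp add: power_le_one)
    next
      case False
      then have "i \<in> V x" using that cls_mem[of x] by auto
      then show ?thesis
        using that by (intro collision_prob_power_le assms) (auto simp: V_def)
    qed
    \<comment> \<open>The last class has no lower bound on weights, so all \<open>n\<close> points
      are counted there.\<close>
    have card: "real (card ?Q) \<le> 2 powr real i * (real n * \<mu>)"
    proof (cases "i = J + 1")
      case True
      have "real (card ?Q) \<le> real n"
        using points card_mono[of P ?Q] by auto
      also have "\<dots> = 1 / \<mu> * (real n * \<mu>)" using mu assms(2) by simp
      also have "\<dots> \<le> 2 powr real i * (real n * \<mu>)"
      proof (rule mult_right_mono)
        have "1 / \<mu> \<le> 2 powr real J" using num_levels_ge assms(2) by simp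
        also have "\<dots> \<le> 2 powr real i" using True by simp
        finally show "1 / \<mu> \<le> 2 powr real i" .
      qed (use N in simp)
      finally show ?thesis .
    next
      case False
      have "2 powr (- real i) \<le> weight x" if "x \<in> ?Q" for x
      proof (rule ccontr)
        assume "\<not> ?thesis"
        \<comment> \<open>A weight below \<open>2 powr (- i)\<close> would admit index
          \<open>i + 1\<close>, against the maximality of \<open>cls x\<close>.\<close>
        then have "i + 1 \<in> V x" using i False by (auto simp: V_def)
        then show False using cls_ge[of "i + 1" x] that by simp
      qed
      then show ?thesis by (intro card_heavy_le assms) auto
    qed
    have "(\<Sum>x\<in>?Q. g x) \<le> (\<Sum>x\<in>?Q. 1 / (2 powr real j * (real n * \<mu>)) * 2 powr (real j - real i))"
      unfolding g_def using sample_prob_bounds[OF assms(2)] coll N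
      by (intro sum_mono mult_mono) auto
    also have "\<dots> = real (card ?Q) / (2 powr real i * (real n * \<mu>))"
      by (simp add: powr_diff)
    also have "\<dots> \<le> 1" using card N by simp
    finally show ?thesis .
  qed
  have "(\<Sum>x\<in>P. g x) = (\<Sum>i\<in>{j..J + 1}. \<Sum>x\<in>{x\<in>P. cls x = i}. g x)"
    using cls_range points(2) by (intro sum.group[symmetric]) auto
  also have "\<dots> \<le> (\<Sum>i\<in>{j..J + 1}. 1)" by (intro sum_mono class_bound)
  \<comment> \<open>There are \<open>J + 2 - j\<close> classes, and
    \<open>j \<ge> 1\<close>.\<close>
  also have "\<dots> \<le> real J + 1" using assms(4) by simp
  finally show ?thesis by (simp add: g_def)
qed

section \<open>Expected running time\<close>

lemma prob_space_H: "j \<in> {1..J} \<Longrightarrow> prob_space (H j)"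
  using lsh by (simp add: andoni_indyk_lsh_def)

lemma prob_space_level_space: "j \<in> {1..J} \<Longrightarrow> prob_space (level_space j)"
  unfolding level_space_def
  by (intro prob_space_pair prob_space_PiM prob_space_H prob_space_measure_pmf)

text \<open>The event is a rectangle: one side says that the sample contains \<open>x\<close>, the
  other is a cylinder constraining only the coordinates of table \<open>l\<close>. Independence of
  the sample and of the concatenated functions makes its measure a product.\<close>

lemma bucket_event:
  assumes "2 \<le> n" "j \<in> {1..J}" "l < num_tables j" "x \<in> P"
  shows "{D \<in> space (level_space j). x \<in> bucket j D l} \<in> sets (level_space j)"
    and "measure (level_space j) {D \<in> space (level_space j). x \<in> bucket j D l}
      = sample_prob j * collision_prob j x ^ concat_len j"
proof -
  interpret andoni_indyk_lsh "H j" n d \<alpha> \<eta> B b "radius f j" "p_near j" "\<tau> j"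
    by (rule lsh[OF assms(2)])
  define I where "I = {..<num_tables j} \<times> {..<concat_len j}"
  interpret Q: product_prob_space "\<lambda>_. H j" I ..
  define E where "E = {h \<in> space (H j). h x = h q}"
  define T where "T = {l} \<times> {..<concat_len j}"
  define W where "W = {h \<in> space (Pi\<^sub>M I (\<lambda>_. H j)). \<forall>i\<in>T. h i \<in> E}"
  have E: "E \<in> sets (H j)"
    unfolding E_def using points query_point assms(4) by (intro collision_event) auto
  have T: "T \<subseteq> I" "finite T" "card T = concat_len j"
    using assms(3) by (auto simp: T_def I_def)
  have W: "W \<in> sets (Pi\<^sub>M I (\<lambda>_. H j))"
    unfolding W_def using T E by (intro sets.sets_Collect_finite_All sets_Collect_single) auto
  have mem: "x \<in> bucket j (S, h) l \<longleftrightarrow> x \<in> S \<and> h \<in> W" if "h \<in> space (Pi\<^sub>M I (\<lambda>_. H j))" for S h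
  proof -
    have "h i \<in> space (H j)" if "i \<in> T" for i
      using that T \<open>h \<in> space _\<close> by (auto simp: space_PiM)
    then show ?thesis
      using that assms(4) by (auto simp: bucket_def W_def E_def T_def)
  qed
  have eq: "{D \<in> space (level_space j). x \<in> bucket j D l} = {S. x \<in> S} \<times> W"
    using mem unfolding level_space_def I_def[symmetric]
    by (auto simp: space_pair_measure W_def)
  show "{D \<in> space (level_space j). x \<in> bucket j D l} \<in> sets (level_space j)"
    unfolding eq unfolding level_space_def I_def[symmetric] using W by (intro pair_measureI) auto
  have "emeasure (level_space j) ({S. x \<in> S} \<times> W)
      = emeasure (bernoulli_sample P (sample_prob j)) {S. x \<in> S} * emeasure (Pi\<^sub>M I (\<lambda>_. H j)) W"
    unfolding level_space_def I_def[symmetric] using W by (intro Q.emeasure_pair_measure_Times) auto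
  also have "emeasure (Pi\<^sub>M I (\<lambda>_. H j)) W = (\<Prod>i\<in>T. emeasure (H j) E)"
    unfolding W_def using T E by (intro Q.emeasure_PiM_Collect) auto
  also have "\<dots> = ennreal (collision_prob j x ^ concat_len j)"
    using T(3) by (simp add: emeasure_eq_measure ennreal_power E_def)
  also have "emeasure (bernoulli_sample P (sample_prob j)) {S. x \<in> S} = ennreal (sample_prob j)"
    using prob_mem_bernoulli_sample[OF points(2) assms(4)] sample_prob_bounds[OF assms(1)]
    by (simp add: measure_pmf.emeasure_eq_measure)
  finally show "measure (level_space j) {D \<in> space (level_space j). x \<in> bucket j D l}
      = sample_prob j * collision_prob j x ^ concat_len j"
    unfolding eq using sample_prob_bounds[OF assms(1)]
    by (simp add: measure_def enn2real_mult)
qed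

lemma card_bucket: "real (card (bucket j D l)) = (\<Sum>x\<in>P. of_bool (x \<in> bucket j D l))"
proof -
  have "bucket j D l \<subseteq> P" by (auto simp: bucket_def)
  then have "P \<inter> {x. x \<in> bucket j D l} = bucket j D l" by auto
  then show ?thesis using points(2) by (simp add: of_bool_def sum.If_cases)
qed

text \<open>Linearity over the points suffices, although they share their hash functions.\<close>

lemma expectation_card_bucket:
  assumes "0 < b" "2 \<le> n" "\<alpha> < 1" "j \<in> {1..J}" "l < num_tables j"
  shows "integrable (level_space j) (\<lambda>D. real (card (bucket j D l)))"
    and "(\<integral>D. real (card (bucket j D l)) \<partial>level_space j) \<le> real J + 1"
proof -
  interpret prob_space "level_space j" by (rule prob_space_level_space[OF assms(4)])
  let ?S = "\<lambda>x. {D \<in> space (level_space j). x \<in> bucket j D l}"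
  note ev = bucket_event[OF assms(2,4,5)]
  have int: "integrable (level_space j) (\<lambda>D. of_bool (x \<in> bucket j D l) :: real)"
    and val: "(\<integral>D. of_bool (x \<in> bucket j D l) \<partial>level_space j)
      = sample_prob j * collision_prob j x ^ concat_len j" if "x \<in> P" for x
  proof -
    have eq: "D \<in> space (level_space j) \<Longrightarrow> of_bool (x \<in> bucket j D l) = (indicator (?S x) D :: real)" for D
      by (auto simp: indicator_def)
    have ind: "integrable (level_space j) (indicator (?S x) :: _ \<Rightarrow> real)"
      using ev(1)[OF that] by (intro integrable_real_indicator) (auto simp: emeasure_eq_measure)
    show "integrable (level_space j) (\<lambda>D. of_bool (x \<in> bucket j D l) :: real)"
      using ind by (simp only: Bochner_Integration.integrable_cong[OF refl eq])
    have "(\<integral>D. of_bool (x \<in> bucket j D l) \<partial>level_space j) = (\<integral>D. (indicator (?S x) D :: real) \<partial>level_space j)"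
      by (intro Bochner_Integration.integral_cong refl eq)
    also have "\<dots> = measure (level_space j) (?S x)" using ev(1)[OF that] by simp
    finally show "(\<integral>D. of_bool (x \<in> bucket j D l) \<partial>level_space j)
      = sample_prob j * collision_prob j x ^ concat_len j" using ev(2)[OF that] by simp
  qed
  show "integrable (level_space j) (\<lambda>D. real (card (bucket j D l)))"
    unfolding card_bucket using int by (intro Bochner_Integration.integrable_sum)
  show "(\<integral>D. real (card (bucket j D l)) \<partial>level_space j) \<le> real J + 1"
    unfolding card_bucket using expected_bucket_le[OF assms(1-4)] int val
    by (subst Bochner_Integration.integral_sum) auto
qed

section \<open>Cost of a single repetition\<close>

definition rep_space ::
    "((nat \<Rightarrow> (nat \<Rightarrow> real) set \<times> (nat \<times> nat \<Rightarrow> (nat \<Rightarrow> real) \<Rightarrow> 'b)) \<times> (nat \<Rightarrow> real) set) measure" where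
  "rep_space = (\<Pi>\<^sub>M j\<in>{1..J}. level_space j) \<Otimes>\<^sub>M measure_pmf (bernoulli_sample P (1 / real n))"

lemma prob_space_rep_space: "prob_space rep_space"
  unfolding rep_space_def
  by (intro prob_space_pair prob_space_PiM prob_space_level_space prob_space_measure_pmf)

lemma expectation_rep_bucket:
  assumes "0 < b" "2 \<le> n" "\<alpha> < 1" "j \<in> {1..J}" "l < num_tables j"
  shows "integrable rep_space (\<lambda>R. real (card (bucket j (fst R j) l)))"
    and "(\<integral>R. real (card (bucket j (fst R j) l)) \<partial>rep_space) \<le> real J + 1"
proof -
  note 1 = expectation_card_bucket[OF assms]
  note 2 = integral_PiM_component[where I = "{1..J}" and M = level_space, OF prob_space_level_space assms(4) 1(1)]
  note 3 = integral_pair_fst[OF prob_space_measure_pmf[of "bernoulli_sample P (1 / real n)"] 2(1)]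
  show "integrable rep_space (\<lambda>R. real (card (bucket j (fst R j) l)))"
    using 3(1) by (simp add: rep_space_def)
  show "(\<integral>R. real (card (bucket j (fst R j) l)) \<partial>rep_space) \<le> real J + 1"
    using 1(2) 2(2) 3(2) by (simp add: rep_space_def)
qed

text \<open>The space also contains infinite sets as samples, whose \<open>card\<close> is 0 by
  convention; the third claim discards them as a null set.\<close>

lemma expectation_rep_sample:
  assumes "2 \<le> n"
  shows "integrable rep_space (\<lambda>R. real (card (snd R)))"
    and "(\<integral>R. real (card (snd R)) \<partial>rep_space) = 1"
    and "AE R in rep_space. finite (snd R)"
proof -
  let ?B = "bernoulli_sample P (1 / real n)"
  have M: "prob_space (\<Pi>\<^sub>M j\<in>{1..J}. level_space j)"
    by (intro prob_space_PiM prob_space_level_space)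
  have s: "0 \<le> 1 / real n" "1 / real n \<le> 1" using assms by auto
  note 1 = expectation_card_bernoulli_sample[OF points(2) s]
  note 2 = integral_pair_snd[OF M prob_space_measure_pmf 1(1)]
  show "integrable rep_space (\<lambda>R. real (card (snd R)))" using 2(1) by (simp add: rep_space_def)
  show "(\<integral>R. real (card (snd R)) \<partial>rep_space) = 1"
    using 2(2) 1(2) points(3) assms by (simp add: rep_space_def)
  have "AE S in ?B. finite S"
  proof (rule AE_pmfI)
    fix S assume "S \<in> set_pmf ?B"
    then have "S \<subseteq> P" using set_bernoulli_sample by fast
    then show "finite S" using points(2) by (rule finite_subset)
  qed
  then have "AE S in distr rep_space ?B snd. finite S"
    unfolding rep_space_def by (simp only: distr_pair_snd_prob[OF M prob_space_measure_pmf])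
  then show "AE R in rep_space. finite (snd R)"
    by (rule AE_distrD[rotated]) (simp add: rep_space_def)
qed

lemma recovered_subset: "recovered R \<subseteq> P"
  by (auto simp: recovered_def bucket_def last_level_def)

text \<open>A recovered point was scanned in some bucket or in the sample of rate
  \<open>1 / n\<close>, so the output phase can be charged to the scanning phase. For infinite
  \<open>snd R\<close> the last summand would be 0.\<close>

lemma card_recovered_le:
  assumes "finite (snd R)"
  shows "real (card (recovered R))
    \<le> (\<Sum>j\<in>{1..J}. \<Sum>l<num_tables j. real (card (bucket j (fst R j) l))) + real (card (snd R))"
proof -
  have fin: "finite (bucket j D l)" for j D l
    using points(2) by (rule finite_subset[rotated]) (auto simp: bucket_def)
  let ?U = "\<Union>j\<in>{1..J}. \<Union>l<num_tables j. bucket j (fst R j) l"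
  have "card (recovered R) \<le> card (?U \<union> snd R)"
    using fin assms by (intro card_mono) (auto simp: recovered_def)
  also have "\<dots> \<le> card ?U + card (snd R)" by (rule card_Un_le)
  also have "card ?U \<le> (\<Sum>j\<in>{1..J}. card (\<Union>l<num_tables j. bucket j (fst R j) l))"
    by (rule card_UN_le) simp
  also have "\<dots> \<le> (\<Sum>j\<in>{1..J}. \<Sum>l<num_tables j. card (bucket j (fst R j) l))"
    by (intro sum_mono card_UN_le) simp
  finally have "real (card (recovered R)) \<le> real ((\<Sum>j\<in>{1..J}. \<Sum>l<num_tables j. card (bucket j (fst R j) l))
      + card (snd R))" by (simp only: of_nat_le_iff add_right_mono)
  then show ?thesis by (simp only: of_nat_add of_nat_sum)
qed

text \<open>The function is bounded by \<open>n\<close>, so only measurability is at stake.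
  Membership of a fixed point in the recovered set is a finite Boolean combination of bucket and
  sample events.\<close>

lemma integrable_card_recovered:
  assumes "2 \<le> n"
  shows "integrable rep_space (\<lambda>R. real (card (recovered R)))"
proof -
  interpret prob_space rep_space by (rule prob_space_rep_space)
  have pred_bucket: "Measurable.pred rep_space (\<lambda>R. x \<in> bucket j (fst R j) l)"
    if "j \<in> {1..J}" "l < num_tables j" "x \<in> P" for j l x
  proof -
    have "Measurable.pred (level_space j) (\<lambda>D. x \<in> bucket j D l)"
      using bucket_event(1)[OF assms that] by (simp add: pred_def)
    moreover have "(\<lambda>R. fst R j) \<in> measurable rep_space (level_space j)"
      unfolding rep_space_def using that by measurable
    ultimately show ?thesis by (rule measurable_compose[rotated])
  qed
  have pred_sample: "Measurable.pred rep_space (\<lambda>R. x \<in> snd R)" for x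
  proof -
    have "snd \<in> measurable rep_space (measure_pmf (bernoulli_sample P (1 / real n)))"
      by (simp add: rep_space_def)
    moreover have "Measurable.pred (measure_pmf (bernoulli_sample P (1 / real n))) (\<lambda>S. x \<in> S)"
      by simp
    ultimately show ?thesis by (rule measurable_compose)
  qed
  have pred: "Measurable.pred rep_space (\<lambda>R. x \<in> recovered R)" if "x \<in> P" for x
  proof -
    have "(\<lambda>R. x \<in> recovered R) = (\<lambda>R. (\<exists>j\<in>{1..J}. \<exists>l\<in>{..<num_tables j}.
        x \<in> bucket j (fst R j) l \<and> x \<in> level j) \<or> x \<in> snd R \<and> x \<in> last_level)"
      by (auto simp: recovered_def fun_eq_iff)
    also have "Measurable.pred rep_space \<dots>"
      using pred_bucket pred_sample that
      by (intro pred_intros_logic pred_intros_finite) auto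
    finally show ?thesis .
  qed
  have eq: "real (card (recovered R)) = (\<Sum>x\<in>P. of_bool (x \<in> recovered R))" for R
  proof -
    have "P \<inter> {x. x \<in> recovered R} = recovered R" using recovered_subset[of R] by auto
    then show ?thesis using points(2) by (simp add: of_bool_def sum.If_cases)
  qed
  show ?thesis
  proof (rule integrable_const_bound[where B = "real n"])
    show "AE R in rep_space. norm (real (card (recovered R))) \<le> real n"
      using card_mono[OF points(2) recovered_subset] points(3) by auto
    show "(\<lambda>R. real (card (recovered R))) \<in> borel_measurable rep_space"
      unfolding eq of_bool_def using pred by measurable
  qed
qed

text \<open>Per table, \<open>2 * J + 3\<close> counts one lookup plus \<open>J + 1\<close> points
  expected in the bucket, charged once for scanning and once for output. The final
  \<open>2 * \<sigma>\<close> charges the one point expected in the \<open>1 / n\<close> sample in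
  the same two ways.\<close>

lemma expectation_rep_time:
  assumes "0 < b" "2 \<le> n" "\<alpha> < 1"
  shows "integrable rep_space rep_time"
    and "(\<integral>R. rep_time R \<partial>rep_space) \<le> (\<Sum>j\<in>{1..J}. real (num_tables j) *
      (real (concat_len j) * \<tau> j + (2 * real J + 3) * \<sigma>)) + 2 * \<sigma>"
proof -
  interpret prob_space rep_space by (rule prob_space_rep_space)
  define Y where "Y j l R = real (card (bucket j (fst R j) l))" for j l
    and R :: "(nat \<Rightarrow> (nat \<Rightarrow> real) set \<times> (nat \<times> nat \<Rightarrow> (nat \<Rightarrow> real) \<Rightarrow> 'b)) \<times> (nat \<Rightarrow> real) set"
  have Y: "integrable rep_space (Y j l)" "expectation (Y j l) \<le> real J + 1"
    if "j \<in> {1..J}" "l \<in> {..<num_tables j}" for j l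
    using expectation_rep_bucket[OF assms] that by (auto simp: Y_def[abs_def])
  note X = expectation_rep_sample[OF assms(2)]
  note Z = integrable_card_recovered[OF assms(2)]
  have YY: "integrable rep_space (\<lambda>R. \<Sum>j\<in>{1..J}. \<Sum>l<num_tables j. Y j l R)"
    by (rule integral_double_sum(1)) (rule Y(1))
  have "expectation (\<lambda>R. real (card (recovered R)))
      \<le> expectation (\<lambda>R. (\<Sum>j\<in>{1..J}. \<Sum>l<num_tables j. Y j l R) + real (card (snd R)))"
  proof (rule integral_mono_AE)
    show "AE R in rep_space. real (card (recovered R))
        \<le> (\<Sum>j\<in>{1..J}. \<Sum>l<num_tables j. Y j l R) + real (card (snd R))"
      using X(3) by eventually_elim (simp only: Y_def card_recovered_le)
  qed (intro Z YY X Bochner_Integration.integrable_add)+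
  also have "\<dots> = (\<Sum>j\<in>{1..J}. \<Sum>l<num_tables j. expectation (Y j l)) + 1"
    using Bochner_Integration.integral_add[OF YY X(1)]
      integral_double_sum(2)[where S = "{1..J}" and T = "\<lambda>j. {..<num_tables j}", OF Y(1)]
    by (simp only: X(2))
  finally have EZ: "expectation (\<lambda>R. real (card (recovered R)))
      \<le> (\<Sum>j\<in>{1..J}. \<Sum>l<num_tables j. expectation (Y j l)) + 1" .
  have rep: "rep_time = (\<lambda>R. (\<Sum>j\<in>{1..J}. \<Sum>l<num_tables j.
        real (concat_len j) * \<tau> j + (1 + Y j l R) * \<sigma>)
     + real (card (snd R)) * \<sigma> + real (card (recovered R)) * \<sigma>)"
    by (simp add: rep_time_def fun_eq_iff Y_def)
  have int1: "integrable rep_space (\<lambda>R. real (concat_len j) * \<tau> j + (1 + Y j l R) * \<sigma>)"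
    if "j \<in> {1..J}" "l \<in> {..<num_tables j}" for j l
    using Y(1)[OF that] by simp
  have int2: "integrable rep_space (\<lambda>R. \<Sum>j\<in>{1..J}. \<Sum>l<num_tables j.
        real (concat_len j) * \<tau> j + (1 + Y j l R) * \<sigma>)"
    by (rule integral_double_sum(1)) (rule int1)
  have int3: "integrable rep_space (\<lambda>R. real (card (snd R)) * \<sigma>)"
    "integrable rep_space (\<lambda>R. real (card (recovered R)) * \<sigma>)"
    using X(1) Z by auto
  show "integrable rep_space rep_time"
    unfolding rep by (intro Bochner_Integration.integrable_add int2 int3)
  have "expectation rep_time = (\<Sum>j\<in>{1..J}. \<Sum>l<num_tables j.
        expectation (\<lambda>R. real (concat_len j) * \<tau> j + (1 + Y j l R) * \<sigma>))
     + \<sigma> + expectation (\<lambda>R. real (card (recovered R))) * \<sigma>"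
    unfolding rep
    using Bochner_Integration.integral_add[OF int2 int3(1)]
      integral_double_sum(2)[where S = "{1..J}" and T = "\<lambda>j. {..<num_tables j}", OF int1]
      Bochner_Integration.integral_add[OF Bochner_Integration.integrable_add[OF int2 int3(1)] int3(2)]
    by (simp only: integral_mult_left_zero X(2) mult_1_left)
  also have "\<dots> = (\<Sum>j\<in>{1..J}. \<Sum>l<num_tables j.
        real (concat_len j) * \<tau> j + (1 + expectation (Y j l)) * \<sigma>)
     + \<sigma> + expectation (\<lambda>R. real (card (recovered R))) * \<sigma>"
    using Y(1) by (intro arg_cong2[where f = "(+)"] refl sum.cong) (simp add: prob_space)
  also have "\<dots> \<le> (\<Sum>j\<in>{1..J}. \<Sum>l<num_tables j.
        real (concat_len j) * \<tau> j + (1 + expectation (Y j l)) * \<sigma>)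
     + \<sigma> + ((\<Sum>j\<in>{1..J}. \<Sum>l<num_tables j. expectation (Y j l)) + 1) * \<sigma>"
    using EZ point_time by (intro add_left_mono mult_right_mono)
  also have "\<dots> = (\<Sum>j\<in>{1..J}. \<Sum>l<num_tables j.
        real (concat_len j) * \<tau> j + (1 + 2 * expectation (Y j l)) * \<sigma>) + 2 * \<sigma>"
    by (simp add: algebra_simps sum.distrib sum_distrib_left sum_distrib_right)
  also have "\<dots> \<le> (\<Sum>j\<in>{1..J}. \<Sum>l<num_tables j.
        real (concat_len j) * \<tau> j + (2 * real J + 3) * \<sigma>) + 2 * \<sigma>"
  proof (intro add_right_mono sum_mono add_left_mono mult_right_mono)
    fix j l assume "j \<in> {1..J}" "l \<in> {..<num_tables j}"
    then show "1 + 2 * expectation (Y j l) \<le> 2 * real J + 3" using Y(2)[of j l] by simp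
  qed (use point_time in auto)
  finally show "expectation rep_time \<le> (\<Sum>j\<in>{1..J}. real (num_tables j) *
      (real (concat_len j) * \<tau> j + (2 * real J + 3) * \<sigma>)) + 2 * \<sigma>" by simp
qed

text \<open>The repetitions have the common law \<open>rep_space\<close>, so linearity of
  expectation gives the factor \<open>num_reps\<close>.\<close>

lemma expectation_query_time:
  assumes "0 < b" "2 \<le> n" "\<alpha> < 1"
  shows "integrable preprocessing_space query_time"
    and "(\<integral>\<omega>. query_time \<omega> \<partial>preprocessing_space) = real num_reps * (\<integral>R. rep_time R \<partial>rep_space)"
proof -
  have space: "preprocessing_space = Pi\<^sub>M {..<num_reps} (\<lambda>_. rep_space)"
    by (simp add: preprocessing_space_def rep_space_def)
  have time: "query_time = (\<lambda>\<omega>. \<Sum>a<num_reps. rep_time (\<omega> a))"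
    by (simp add: query_time_def query_def fun_eq_iff)
  note rep = integral_PiM_component[where I = "{..<num_reps}" and M = "\<lambda>_. rep_space",
      OF prob_space_rep_space _ expectation_rep_time(1)[OF assms]]
  show "integrable preprocessing_space query_time"
    unfolding space time by (intro Bochner_Integration.integrable_sum rep(1))
  show "(\<integral>\<omega>. query_time \<omega> \<partial>preprocessing_space) = real num_reps * (\<integral>R. rep_time R \<partial>rep_space)"
    unfolding space time by (simp add: Bochner_Integration.integral_sum rep)
qed

section \<open>Parameter bounds\<close>

text \<open>By the upper bound on \<open>k * l\<close>, the power \<open>p powr (- k)\<close> is at
  most \<open>level_cost / p\<close>, and the lower bound on \<open>p_near\<close> turns
  \<open>1 / p\<close> into the exponential factor.\<close>

lemma num_tables_le:
  assumes "0 < b" "2 \<le> n" "\<alpha> < 1" "j \<in> {1..J}"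
  shows "real (num_tables j) \<le> 101 * log 2 (real n)
    * (kernel_cost n \<alpha> f \<mu> * exp (\<bar>B\<bar> * sqrt (log 2 (real n) powr (2 / 3))))"
proof -
  define W where "W = sqrt (log 2 (real n) powr (2 / 3))"
  define Q where "Q = kernel_cost n \<alpha> f \<mu> * exp (\<bar>B\<bar> * W)"
  note p = p_near_bounds[OF assms(4)]
  have W: "0 \<le> W" by (simp add: W_def)
  have L: "1 \<le> log 2 (real n)" using assms(2) by simp
  have "p_near j powr (- real (concat_len j)) = (2 powr log 2 (p_near j)) powr (- real (concat_len j))"
    using p by simp
  also have "\<dots> = 2 powr (real (concat_len j) * - log 2 (p_near j))"
    by (simp only: powr_powr) (simp add: mult_ac)
  also have "\<dots> \<le> 2 powr (real_of_int (cost_exponent n \<alpha> f \<mu> j) - log 2 (p_near j))"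
    using concat_len_bounds(2)[OF assms] by simp
  also have "\<dots> = level_cost n \<alpha> f \<mu> j * (1 / p_near j)"
    using p by (simp add: powr_diff level_cost_def)
  also have "\<dots> \<le> Q"
    unfolding Q_def
  proof (intro mult_mono level_cost_le_kernel_cost assms)
    have "exp (- (\<bar>B\<bar> * W)) \<le> exp (- B * W)"
      using W mult_right_mono[of B "\<bar>B\<bar>" W] by simp
    also have "\<dots> \<le> p_near j" using p(2) by (simp add: W_def)
    finally have "exp (- (\<bar>B\<bar> * W)) \<le> p_near j" .
    then show "1 / p_near j \<le> exp (\<bar>B\<bar> * W)"
      using p(1) by (simp add: exp_minus field_simps)
    show "0 \<le> kernel_cost n \<alpha> f \<mu>" using kernel_cost_ge_1[OF assms(2,3)] by simp
  qed (use p in simp)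
  finally have pk: "p_near j powr (- real (concat_len j)) \<le> Q" .
  have "1 * 1 \<le> Q"
    unfolding Q_def using kernel_cost_ge_1[OF assms(2,3)] W by (intro mult_mono) auto
  then have "1 * 1 \<le> log 2 (real n) * Q" using L by (intro mult_mono) auto
  moreover have "100 * log 2 (real n) * p_near j powr (- real (concat_len j)) \<le> 100 * log 2 (real n) * Q"
    using pk L by (intro mult_left_mono) auto
  moreover have "0 \<le> 100 * log 2 (real n) * p_near j powr (- real (concat_len j))" using L by simp
  then have "real (num_tables j) \<le> 100 * log 2 (real n) * p_near j powr (- real (concat_len j)) + 1"
    unfolding num_tables_def by linarith
  \<comment> \<open>The ceiling adds at most 1, which is below \<open>log 2 n * Q\<close>; so 100
    becomes 101.\<close>
  ultimately have "real (num_tables j) \<le> 101 * log 2 (real n) * Q" by simp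
  then show ?thesis by (simp add: Q_def W_def)
qed

text \<open>The length is at most \<open>E / l + 1\<close> with \<open>E \<le> 2 * J\<close>, and
  \<open>l \<ge> b\<close> because \<open>ln 2 < 1\<close>.\<close>

lemma concat_len_le:
  assumes "0 < b" "2 \<le> n" "\<alpha> \<le> 1 / 2" "j \<in> {1..J}"
  shows "real (concat_len j) \<le> 2 * real J / b + 1"
proof -
  have a: "\<alpha> < 1" using assms by simp
  define l where "l = - log 2 (p_near j)"
  have bl: "b \<le> ln 2 * l" using log_p_near[OF assms(4)] by (simp add: l_def)
  then have "0 < ln 2 * l" using assms(1) by linarith
  then have l: "0 < l" by (simp add: zero_less_mult_iff)
  have "ln 2 * l \<le> 1 * l" using l ln_2_less_1 by (intro mult_right_mono) auto
  then have "b \<le> l" using bl by simp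
  have "real_of_int (cost_exponent n \<alpha> f \<mu> j) \<le> 2 * real J"
    using cost_exponent_le[OF assms(2-4)] by linarith
  then have "real (concat_len j) * l \<le> 2 * real J + l"
    using concat_len_bounds(2)[OF assms(1,2) a assms(4)] by (simp add: l_def)
  then have "real (concat_len j) \<le> 2 * real J / l + 1" using l by (simp add: field_simps)
  also have "2 * real J / l \<le> 2 * real J / b"
    using \<open>b \<le> l\<close> assms(1) by (intro divide_left_mono) auto
  finally show ?thesis by simp
qed

lemma num_reps_le:
  assumes "0 < C" "2 \<le> n"
  shows "real num_reps \<le> (C + 1) * log 2 (real n) * (1 / \<epsilon>\<^sup>2) * real n powr (\<bar>A\<bar> * \<bar>\<beta>\<bar>)"
proof -
  define N where "N = real n powr (\<bar>A\<bar> * \<bar>\<beta>\<bar>)"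
  have L: "1 \<le> log 2 (real n)" using assms(2) by simp
  have mu: "0 < \<mu>" using mu_pos assms(2) by simp
  have N1: "1 \<le> N" unfolding N_def using assms(2) by (intro ge_one_powr_ge_zero) auto
  have eps: "1 \<le> 1 / \<epsilon>\<^sup>2" using precision by (simp add: power_le_one)
  \<comment> \<open>The sign of \<beta> is unknown; since \<open>\<mu> < 1\<close>, passing to its
    absolute value only enlarges the power.\<close>
  have "\<mu> powr (- \<beta>) \<le> \<mu> powr (- \<bar>\<beta>\<bar>)"
    using mu density_range by (intro powr_mono') auto
  also have "\<dots> \<le> (real n powr (- A)) powr (- \<bar>\<beta>\<bar>)"
    using density_range assms(2) by (intro powr_mono2') auto
  also have "\<dots> = real n powr (A * \<bar>\<beta>\<bar>)" by (simp add: powr_powr)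
  also have "\<dots> \<le> N"
    unfolding N_def using assms(2) by (intro powr_mono mult_right_mono) auto
  finally have "C * log 2 (real n) / \<epsilon>\<^sup>2 * \<mu> powr (- \<beta>) \<le> C * log 2 (real n) / \<epsilon>\<^sup>2 * N"
    using L assms(1) by (intro mult_left_mono) auto
  moreover have "1 * 1 * 1 \<le> log 2 (real n) * (1 / \<epsilon>\<^sup>2) * N"
    using L eps N1 by (intro mult_mono) auto
  moreover have "0 \<le> C * log 2 (real n) / \<epsilon>\<^sup>2 * \<mu> powr (- \<beta>)" using L assms(1) by simp
  then have "real num_reps \<le> C * log 2 (real n) / \<epsilon>\<^sup>2 * \<mu> powr (- \<beta>) + 1"
    unfolding num_reps_def by linarith
  ultimately have "real num_reps \<le> C * log 2 (real n) / \<epsilon>\<^sup>2 * N + log 2 (real n) * (1 / \<epsilon>\<^sup>2) * N"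
    by linarith
  then show ?thesis by (simp add: N_def algebra_simps add_divide_distrib)
qed

text \<open>The three logarithms come from the number of levels, the number of tables and the work
  per table. The summand 2 in the constant absorbs the cost of the \<open>1 / n\<close>
  sample.\<close>

lemma expectation_rep_time_le:
  assumes "0 < b" "2 \<le> n" "\<alpha> \<le> 1 / 2"
  defines "a \<equiv> \<bar>A\<bar> + 1"
  shows "(\<integral>R. rep_time R \<partial>rep_space) \<le> (101 * a * (2 * a / b + 2 * a + 4) + 2) * log 2 (real n) ^ 3
    * (kernel_cost n \<alpha> f \<mu> * exp (\<bar>B\<bar> * sqrt (log 2 (real n) powr (2 / 3))) * real n powr \<eta>)"
proof -
  have \<alpha>1: "\<alpha> < 1" using assms by simp
  define L where "L = log 2 (real n)"
  define Q where "Q = kernel_cost n \<alpha> f \<mu> * exp (\<bar>B\<bar> * sqrt (L powr (2 / 3)))"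
  define N where "N = real n powr \<eta>"
  \<comment> \<open>Work per table is at most \<open>2 * J / b + 1\<close> evaluations plus
    \<open>2 * J + 3\<close> point operations; inserting \<open>J \<le> a * L\<close> and
    \<open>1 \<le> L\<close> gives \<open>G * L\<close>.\<close>
  define G where "G = 2 * a / b + 2 * a + 4"
  have L: "1 \<le> L" using assms(2) by (simp add: L_def)
  have a: "1 \<le> a" by (simp add: a_def)
  have G: "0 \<le> G" using a assms(1) by (simp add: G_def)
  have N: "0 \<le> N" by (simp add: N_def)
  have J: "real J \<le> a * L" using num_levels_le[OF assms(2)] by (simp add: a_def L_def)
  have "1 * 1 \<le> Q"
    unfolding Q_def using kernel_cost_ge_1[OF assms(2) \<alpha>1] by (intro mult_mono) auto
  then have Q: "1 \<le> Q" by simp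
  have "(\<integral>R. rep_time R \<partial>rep_space) \<le> (\<Sum>j\<in>{1..J}. real (num_tables j) *
      (real (concat_len j) * \<tau> j + (2 * real J + 3) * \<sigma>)) + 2 * \<sigma>"
    by (rule expectation_rep_time(2)[OF assms(1,2) \<alpha>1])
  also have "\<dots> \<le> (\<Sum>j\<in>{1..J}. (101 * L * Q) * (G * L * N)) + 2 * N"
  proof (intro add_mono sum_mono mult_mono)
    fix j assume j: "j \<in> {1..J}"
    interpret andoni_indyk_lsh "H j" n d \<alpha> \<eta> B b "radius f j" "p_near j" "\<tau> j"
      by (rule lsh[OF j])
    show "real (num_tables j) \<le> 101 * L * Q"
      using num_tables_le[OF assms(1,2) \<alpha>1 j] by (simp add: Q_def L_def)
    have "real (concat_len j) * \<tau> j + (2 * real J + 3) * \<sigma>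
        \<le> (2 * real J / b + 1) * N + (2 * real J + 3) * N"
      using concat_len_le[OF assms(1-3) j] eval_time point_time assms(1)
      by (intro add_mono mult_mono) (auto simp: N_def)
    also have "\<dots> = (2 * real J / b + 2 * real J + 4) * N" by (simp add: algebra_simps)
    also have "\<dots> \<le> (G * L) * N"
    proof (intro mult_right_mono N)
      have "2 * real J / b \<le> 2 * (a * L) / b" using J assms(1) by (intro divide_right_mono) auto
      then have "2 * real J / b + 2 * real J + 4 \<le> 2 * (a * L) / b + 2 * (a * L) + 4 * L"
        using J L by (intro add_mono) auto
      also have "\<dots> = G * L" by (simp add: G_def algebra_simps)
      finally show "2 * real J / b + 2 * real J + 4 \<le> G * L" .
    qed
    finally show "real (concat_len j) * \<tau> j + (2 * real J + 3) * \<sigma> \<le> G * L * N" .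
    show "0 \<le> 101 * L * Q" using L Q by simp
    show "0 \<le> real (concat_len j) * \<tau> j + (2 * real J + 3) * \<sigma>"
      using eval_time point_time by (intro add_nonneg_nonneg mult_nonneg_nonneg) auto
  qed (use point_time in \<open>auto simp: N_def\<close>)
  also have "\<dots> = real J * (101 * G * L^2 * (Q * N)) + 2 * N"
    by (simp add: power2_eq_square mult_ac)
  also have "\<dots> \<le> (a * L) * (101 * G * L^2 * (Q * N)) + 2 * (L ^ 3 * (Q * N))"
  proof (intro add_mono mult_right_mono J mult_left_mono)
    have "1 * N \<le> (L ^ 3 * Q) * N"
      using L Q N mult_mono[of 1 "L ^ 3" 1 Q] by (intro mult_right_mono) auto
    then show "N \<le> L ^ 3 * (Q * N)" by (simp add: mult_ac)
  qed (use L Q N G in auto)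
  also have "\<dots> = (101 * a * G + 2) * L ^ 3 * (Q * N)"
    by (simp add: power2_eq_square power3_eq_cube algebra_simps)
  finally show ?thesis by (simp add: Q_def N_def G_def L_def)
qed

end

text \<open>The existential witnesses precede the dimension, points, kernel, \<mu> and \<epsilon>,
  so the bound is uniform in them; a power of the logarithm expresses the soft O. Integrability is
  claimed as well because the integral of a non-integrable function is 0 by convention.\<close>

theorem theorem4p9:
  fixes A B b C :: real and \<alpha> \<beta> \<eta> :: "nat \<Rightarrow> real"
  assumes "0 < b" and "0 < C"
    and "\<alpha> \<longlonglongrightarrow> 0" and "\<beta> \<longlonglongrightarrow> 0" and "\<eta> \<longlonglongrightarrow> 0"
  shows "\<exists>(\<delta> :: nat \<Rightarrow> real) (D :: real) (s :: nat) (n0 :: nat). \<delta> \<longlonglongrightarrow> 0 \<and>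
    (\<forall>n\<ge>n0. \<forall>d P q f \<mu> \<epsilon> (H :: nat \<Rightarrow> ((nat \<Rightarrow> real) \<Rightarrow> 'b) measure) p_near \<tau> \<sigma>.
       kde_instance A B b (\<alpha> n) (\<eta> n) n d P q f \<mu> \<epsilon> H p_near \<tau> \<sigma> \<longrightarrow>
       integrable (kde_instance.preprocessing_space C (\<alpha> n) (\<beta> n) n P f \<mu> \<epsilon> H p_near)
         (kde_instance.query_time C (\<alpha> n) (\<beta> n) n d P q f \<mu> \<epsilon> p_near \<tau> \<sigma>) \<and>
       prob_space.expectation (kde_instance.preprocessing_space C (\<alpha> n) (\<beta> n) n P f \<mu> \<epsilon> H p_near)
         (kde_instance.query_time C (\<alpha> n) (\<beta> n) n d P q f \<mu> \<epsilon> p_near \<tau> \<sigma>)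
       \<le> D * log 2 (real n) ^ s * (1 / \<epsilon>\<^sup>2 * real n powr \<delta> n * kernel_cost n (\<alpha> n) f \<mu>))"
proof -
  define a where "a = \<bar>A\<bar> + 1"
  define F where "F = 101 * a * (2 * a / b + 2 * a + 4) + 2"
  define W where "W n = sqrt (log 2 (real n) powr (2 / 3))" for n
  \<comment> \<open>The summands account for \<open>\<mu> powr (- \<beta>)\<close>, for the unit
    times, and for \<open>exp (\<bar>B\<bar> * W n)\<close> written as a power of \<open>n\<close>.
    The last one vanishes in the limit because \<open>W n\<close> is the cube root of
    \<open>log 2 n\<close>.\<close>
  define \<delta> where "\<delta> n = \<bar>A\<bar> * \<bar>\<beta> n\<bar> + \<eta> n + \<bar>B\<bar> * (W n / ln (real n))" for n
  have "(\<lambda>n. W n / ln (real n)) \<longlonglongrightarrow> 0"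
    unfolding W_def by real_asymp
  then have "(\<lambda>n. \<bar>A\<bar> * \<bar>\<beta> n\<bar> + \<eta> n + \<bar>B\<bar> * (W n / ln (real n))) \<longlonglongrightarrow> \<bar>A\<bar> * \<bar>0\<bar> + 0 + \<bar>B\<bar> * 0"
    by (intro tendsto_intros assms)
  then have \<delta>: "\<delta> \<longlonglongrightarrow> 0" by (simp add: \<delta>_def[abs_def])
  \<comment> \<open>From this threshold on, \<open>1 - \<alpha> n\<close> exceeds
    \<open>1 / 2\<close>, as needed to bound the cost exponent.\<close>
  have "\<forall>\<^sub>F n in sequentially. \<alpha> n < 1 / 2"
    using assms(3) by (rule order_tendstoD) simp
  then obtain n1 where n1: "\<And>n. n \<ge> n1 \<Longrightarrow> \<alpha> n < 1 / 2"
    by (auto simp: eventually_sequentially)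
  have "integrable (kde_instance.preprocessing_space C (\<alpha> n) (\<beta> n) n P f \<mu> \<epsilon> H p_near)
         (kde_instance.query_time C (\<alpha> n) (\<beta> n) n d P q f \<mu> \<epsilon> p_near \<tau> \<sigma>) \<and>
       prob_space.expectation (kde_instance.preprocessing_space C (\<alpha> n) (\<beta> n) n P f \<mu> \<epsilon> H p_near)
         (kde_instance.query_time C (\<alpha> n) (\<beta> n) n d P q f \<mu> \<epsilon> p_near \<tau> \<sigma>)
       \<le> ((C + 1) * F) * log 2 (real n) ^ 4
         * (1 / \<epsilon>\<^sup>2 * real n powr \<delta> n * kernel_cost n (\<alpha> n) f \<mu>)"
    if n: "max 2 n1 \<le> n"
      and inst: "kde_instance A B b (\<alpha> n) (\<eta> n) n d P q f \<mu> \<epsilon> H p_near \<tau> \<sigma>"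
    for n d P q f \<mu> \<epsilon> and H :: "nat \<Rightarrow> ((nat \<Rightarrow> real) \<Rightarrow> 'b) measure" and p_near \<tau> \<sigma>
  proof -
    interpret kde_instance A B b C "\<alpha> n" "\<beta> n" "\<eta> n" n d P q f \<mu> \<epsilon> H p_near \<tau> \<sigma>
      by (rule inst)
    have n2: "2 \<le> n" and \<alpha>: "\<alpha> n \<le> 1 / 2" "\<alpha> n < 1" using n n1[of n] by auto
    define X where "X = real n powr (\<bar>A\<bar> * \<bar>\<beta> n\<bar>)"
    define L where "L = log 2 (real n)"
    define K where "K = kernel_cost n (\<alpha> n) f \<mu>"
    have L: "1 \<le> L" using n2 by (simp add: L_def)
    have K: "1 \<le> K" using kernel_cost_ge_1[OF n2 \<alpha>(2)] by (simp add: K_def)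
    have F: "0 \<le> F" using assms(1) by (simp add: F_def a_def)
    have "real n powr (\<bar>B\<bar> * (W n / ln (real n))) = exp (\<bar>B\<bar> * W n)"
      using n2 by (simp add: powr_def)
    then have pw: "real n powr \<delta> n = X * real n powr \<eta> n * exp (\<bar>B\<bar> * W n)"
      by (simp add: \<delta>_def powr_add X_def)
    have "(\<integral>\<omega>. query_time \<omega> \<partial>preprocessing_space) = real num_reps * (\<integral>R. rep_time R \<partial>rep_space)"
      by (rule expectation_query_time(2)[OF assms(1) n2 \<alpha>(2)])
    also have "\<dots> \<le> real num_reps * (F * L ^ 3 * (K * exp (\<bar>B\<bar> * W n) * real n powr \<eta> n))"
      using expectation_rep_time_le[OF assms(1) n2 \<alpha>(1)]
      by (intro mult_left_mono) (auto simp: F_def a_def L_def K_def W_def)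
    also have "\<dots> \<le> ((C + 1) * L * (1 / \<epsilon>\<^sup>2) * X)
        * (F * L ^ 3 * (K * exp (\<bar>B\<bar> * W n) * real n powr \<eta> n))"
      using num_reps_le[OF assms(2) n2] F L K by (intro mult_right_mono) (auto simp: L_def X_def)
    \<comment> \<open>The number of repetitions contributes the fourth logarithm and the factor
      \<open>1 / \<epsilon>\<^sup>2\<close>.\<close>
    also have "\<dots> = ((C + 1) * F) * L ^ 4 * (1 / \<epsilon>\<^sup>2 * real n powr \<delta> n * K)"
      by (simp add: pw power4_eq_xxxx power3_eq_cube mult_ac)
    finally show ?thesis
      using expectation_query_time(1)[OF assms(1) n2 \<alpha>(2)] by (simp add: L_def K_def)
  qed
  then show ?thesis using \<delta> by blast
qed

end
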